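(* Let $K$ be a simplicial $(n-1)$-sphere on the vertex set $[m]=\{1,\ldots,m\}$. Then the moment-angle complex $\mathcal Z_K$ is an $(m+n)$-dimensional (closed) manifold.
   Context: A simplicial $(n-1)$-sphere is a finite abstract simplicial complex $K$ whose geometric realisation $|K|$ is homeomorphic to the sphere $S^{n-1}$; here $\{i\}\in K$ for every $i\in[m]$. With $D^2=\{z\in\mathbb C:|z|\le1\}$, the moment-angle complex of $K$ is the subspace $$\mathcal Z_K=\bigcup_{I\in K}\{(z_1,\ldots,z_m)\in(D^2)^m : |z_i|=1\text{ for }i\notin I\}\subset(D^2)^m.$$ "Manifold" means topological manifold; "closed" means compact without boundary. *)

theory Defs
  imports "HOL-Analysis.Analysis"
begin

definition abstract_simplicial_complex :: "'a set \<Rightarrow> 'a set set \<Rightarrow> bool" where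
  "abstract_simplicial_complex V K \<longleftrightarrow>
     K \<subseteq> Pow V \<and> {} \<in> K \<and> (\<forall>I\<in>K. \<forall>J. J \<subseteq> I \<longrightarrow> J \<in> K) \<and> (\<forall>i\<in>V. {i} \<in> K)"

(* Barycentric coordinates: the vertex i is the i-th unit vector, and the inner set is the
   convex hull of the vertices of I (empty for I = {}). The subspace topology is the right
   one for finite complexes only. *)
definition geometric_realisation :: "'a set set \<Rightarrow> ('a \<Rightarrow> real) topology" where
  "geometric_realisation K =
     subtopology (powertop_real UNIV)
       (\<Union>I\<in>K. {x. (\<forall>i. 0 \<le> x i) \<and> (\<forall>i. i \<notin> I \<longrightarrow> x i = 0) \<and> (\<Sum>i\<in>I. x i) = 1})"

(* The sphere of dimension n - 1. The library's nsphere is indexed by the dimension and so has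
   no counterpart for n = 0, where the sphere of dimension -1 is empty. *)
definition unit_sphere :: "nat \<Rightarrow> (nat \<Rightarrow> real) topology" where
  "unit_sphere n = subtopology (Euclidean_space n) {x. (\<Sum>i<n. (x i)\<^sup>2) = 1}"

lemma unit_sphere_Suc: "unit_sphere (Suc d) = nsphere d"
  by (simp add: unit_sphere_def nsphere_def lessThan_Suc_atMost)

lemma topspace_unit_sphere_0: "topspace (unit_sphere 0) = {}"
  by (simp add: unit_sphere_def)

(* K is a simplicial sphere of dimension n - 1 with vertex set V. *)
definition simplicial_sphere :: "nat \<Rightarrow> 'a set \<Rightarrow> 'a set set \<Rightarrow> bool" where
  "simplicial_sphere n V K \<longleftrightarrow>
     finite V \<and> abstract_simplicial_complex V K \<and>
     geometric_realisation K homeomorphic_space unit_sphere n"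

definition moment_angle_complex :: "nat \<Rightarrow> nat set set \<Rightarrow> (nat \<Rightarrow> complex) topology" where
  "moment_angle_complex m K =
     subtopology (product_topology (\<lambda>i. top_of_set (cball 0 1)) {1..m})
       (\<Union>I\<in>K. {z \<in> {1..m} \<rightarrow>\<^sub>E cball 0 1. \<forall>i\<in>{1..m} - I. norm (z i) = 1})"

definition second_countable_space :: "'a topology \<Rightarrow> bool" where
  "second_countable_space X \<longleftrightarrow>
     (\<exists>\<B>. countable \<B> \<and> (\<forall>B\<in>\<B>. openin X B) \<and>
          (\<forall>U x. openin X U \<and> x \<in> U \<longrightarrow> (\<exists>B\<in>\<B>. x \<in> B \<and> B \<subseteq> U)))"

(* Topological manifold without boundary. *)
definition topological_manifold :: "nat \<Rightarrow> 'a topology \<Rightarrow> bool" where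
  "topological_manifold d X \<longleftrightarrow>
     Hausdorff_space X \<and> second_countable_space X \<and>
     (\<forall>x\<in>topspace X. \<exists>U W. openin X U \<and> x \<in> U \<and> openin (Euclidean_space d) W \<and>
        subtopology X U homeomorphic_space subtopology (Euclidean_space d) W)"

definition closed_manifold :: "nat \<Rightarrow> 'a topology \<Rightarrow> bool" where
  "closed_manifold d X \<longleftrightarrow> topological_manifold d X \<and> compact_space X"

end

(* Let C be the cone of all nonnegative vectors whose support is a face of K. Radial extension of a
   homeomorphism between |K| and the sphere identifies C with R^n. Near a point z, each disc factor
   has coordinates (r, s) with r >= 0 and with r = 0 exactly on the boundary circle. In these
   coordinates the condition defining the moment-angle complex says that (r_1, ..., r_m) lies in C,
   so the complex is locally an open subset of C x R^m, that is, of R^(m+n). Links of faces never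
   enter, so it does not matter that they need not be spheres. *)

theory Submission
  imports Defs
begin

section \<open>Subspaces of function spaces\<close>

lemma homeomorphic_space_top_of_set:
  "top_of_set S homeomorphic_space top_of_set T \<longleftrightarrow> S homeomorphic T"
proof
  assume "top_of_set S homeomorphic_space top_of_set T"
  then obtain f g where "continuous_on S f" "f ` S \<subseteq> T" "continuous_on T g" "g ` T \<subseteq> S"
    "\<And>x. x \<in> S \<Longrightarrow> g (f x) = x" "\<And>y. y \<in> T \<Longrightarrow> f (g y) = y"
    by (auto simp: homeomorphic_space_def homeomorphic_maps_def continuous_map_subtopology_eu
        image_subset_iff_funcset)
  then show "S homeomorphic T"
    unfolding homeomorphic_def by (blast intro: homeomorphismI)
next
  assume "S homeomorphic T"
  then obtain f g where "homeomorphism S T f g"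
    by (auto simp: homeomorphic_def)
  then show "top_of_set S homeomorphic_space top_of_set T"
    unfolding homeomorphic_space_def homeomorphic_maps_def homeomorphism_def
    by (intro exI[of _ f] exI[of _ g]) (auto simp: continuous_map_subtopology_eu)
qed

text \<open>Points of the product over \<open>I\<close> are \<open>undefined\<close> outside
  \<open>I\<close>, so the extra coordinates seen by the topology of the full function type are
  constant and add no open sets. This allows the moment-angle complex to be treated as a plain
  subset of a function space.\<close>

lemma top_of_set_PiE:
  fixes S :: "'i \<Rightarrow> 'b::topological_space set"
  shows "product_topology (\<lambda>i. top_of_set (S i)) I = top_of_set (PiE I S)"
proof -
  have "continuous_map (top_of_set (PiE I S)) (product_topology (\<lambda>i. top_of_set (S i)) I) id"
    by (auto simp: continuous_map_componentwise continuous_map_subtopology_eu PiE_iff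
        intro!: continuous_on_product_coordinates continuous_on_subset[OF continuous_on_product_coordinates])
  moreover have "continuous_map (product_topology (\<lambda>i. top_of_set (S i)) I) (top_of_set (PiE I S)) id"
    unfolding continuous_map_in_subtopology euclidean_product_topology[symmetric]
      continuous_map_componentwise_UNIV
  proof (intro conjI allI)
    fix k
    show "continuous_map (product_topology (\<lambda>i. top_of_set (S i)) I) euclidean (\<lambda>x. id x k)"
    proof (cases "k \<in> I")
      case True
      then show ?thesis
        using continuous_map_product_projection[of k I "\<lambda>i. top_of_set (S i)"]
        by (simp add: continuous_map_in_subtopology)
    next
      case False
      \<comment> \<open>A coordinate outside \<open>I\<close> is constantly \<open>undefined\<close>
        on the product.\<close>
      have "continuous_map (product_topology (\<lambda>i. top_of_set (S i)) I) euclidean (\<lambda>x. undefined :: 'b)"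
        by simp
      then show ?thesis
        by (rule continuous_map_eq) (use False in \<open>auto simp: PiE_iff extensional_def\<close>)
    qed
  qed simp
  ultimately have "homeomorphic_maps (top_of_set (PiE I S)) (product_topology (\<lambda>i. top_of_set (S i)) I) id id"
    by (simp add: homeomorphic_maps_def)
  then show ?thesis
    unfolding homeomorphic_maps_id .
qed

section \<open>Cones with a gauge, and radial extension\<close>

text \<open>A common frame for the cone over |K|, with the coordinate sum as gauge, and for
  Euclidean space, with its norm. The coordinate bound makes the gauge vanish only at the apex and
  bounds the coordinates on the base by 1.\<close>

locale gauged_cone =
  fixes C :: "('a \<Rightarrow> real) set" and p :: "('a \<Rightarrow> real) \<Rightarrow> real"
  assumes zero_mem: "(\<lambda>_. 0) \<in> C"
    and scale_mem: "x \<in> C \<Longrightarrow> 0 \<le> c \<Longrightarrow> (\<lambda>i. c * x i) \<in> C"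
    and gauge_scale: "x \<in> C \<Longrightarrow> 0 \<le> c \<Longrightarrow> p (\<lambda>i. c * x i) = c * p x"
    and abs_le_gauge: "x \<in> C \<Longrightarrow> \<bar>x i\<bar> \<le> p x"
    and continuous_gauge: "continuous_on C p"
begin

definition base :: "('a \<Rightarrow> real) set" where
  "base = {x \<in> C. p x = 1}"

text \<open>The homogeneous extension of a map from the base. At the apex the factor
  \<open>p x\<close> is 0, so the value is 0 whatever \<open>f\<close> does there.\<close>

definition radial :: "(('a \<Rightarrow> real) \<Rightarrow> 'b \<Rightarrow> real) \<Rightarrow> ('a \<Rightarrow> real) \<Rightarrow> 'b \<Rightarrow> real" where
  "radial f x = (\<lambda>i. p x * f (\<lambda>j. x j / p x) i)"

lemma gauge_nonneg: "x \<in> C \<Longrightarrow> 0 \<le> p x"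
  using abs_le_gauge[of x] by (meson abs_ge_zero order_trans)

lemma gauge_eq_0: "x \<in> C \<Longrightarrow> p x = 0 \<Longrightarrow> x = (\<lambda>_. 0)"
  using abs_le_gauge[of x] by fastforce

lemma normalize_mem:
  assumes "x \<in> C" "p x \<noteq> 0"
  shows "(\<lambda>j. x j / p x) \<in> base"
  using scale_mem[of x "1 / p x"] gauge_scale[of x "1 / p x"] gauge_nonneg[of x] assms
  by (simp add: base_def)

text \<open>Off the apex the map is composed of continuous maps. At the apex each coordinate is
  squeezed by the gauge, which tends to 0; this is where boundedness of \<open>f\<close>
  enters.\<close>

lemma continuous_on_radial:
  assumes cont: "continuous_on base f" and bdd: "\<And>x i. x \<in> base \<Longrightarrow> \<bar>f x i\<bar> \<le> 1"
  shows "continuous_on C (radial f)"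
proof (rule continuous_on_coordinatewise_then_product)
  fix i
  have bound: "\<bar>radial f x i\<bar> \<le> p x" if "x \<in> C" for x
  proof (cases "p x = 0")
    case False
    then show ?thesis
      using bdd[OF normalize_mem[OF that False], of i] gauge_nonneg[OF that]
      by (simp add: radial_def abs_mult mult_left_le)
  qed (simp add: radial_def)
  show "continuous_on C (\<lambda>x. radial f x i)"
    unfolding continuous_on_def
  proof
    fix x assume x: "x \<in> C"
    have p_tendsto: "(p \<longlongrightarrow> p x) (at x within C)"
      using continuous_gauge x by (simp add: continuous_on_def)
    show "((\<lambda>x. radial f x i) \<longlongrightarrow> radial f x i) (at x within C)"
    proof (cases "p x = 0")
      case True
      have "((\<lambda>x. radial f x i) \<longlongrightarrow> 0) (at x within C)"
        by (rule Lim_null_comparison[where g = p])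
          (use p_tendsto True bound in \<open>auto simp: eventually_at_filter\<close>)
      then show ?thesis
        using True by (simp add: radial_def)
    next
      case False
      let ?U = "C \<inter> p -` (- {0})"
      have "continuous_on ?U (\<lambda>x j. x j / p x)"
        by (intro continuous_on_coordinatewise_then_product continuous_intros
            continuous_on_subset[OF continuous_gauge]
            continuous_on_subset[OF continuous_on_product_coordinates]) auto
      then have "continuous_on ?U (\<lambda>x. f (\<lambda>j. x j / p x))"
        by (rule continuous_on_compose2[OF cont]) (use normalize_mem in auto)
      then have "continuous_on ?U (\<lambda>x. f (\<lambda>j. x j / p x) i)"
        by (rule continuous_on_product_then_coordinatewise)
      then have "continuous_on ?U (\<lambda>x. radial f x i)"
        unfolding radial_def
        by (intro continuous_on_mult continuous_on_subset[OF continuous_gauge]) auto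
      then have "((\<lambda>x. radial f x i) \<longlongrightarrow> radial f x i) (at x within ?U)"
        using x False by (auto simp: continuous_on_def)
      \<comment> \<open>The cone without its apex is relatively open, so limits within it and within
        \<open>C\<close> agree.\<close>
      moreover have "openin (top_of_set C) ?U"
        by (rule continuous_openin_preimage_gen[OF continuous_gauge]) (simp add: open_Compl)
      then obtain T where "open T" "?U = C \<inter> T"
        by (auto simp: openin_open)
      then have "at x within C = at x within ?U"
        using x False by (intro at_within_nhd[of x T]) auto
      ultimately show ?thesis
        by simp
    qed
  qed
qed

end

text \<open>Since \<open>f\<close> lands in the base of \<open>D\<close>, the point
  \<open>radial f x\<close> has gauge \<open>p x\<close>; normalising it gives back the value of
  \<open>f\<close>, which \<open>g\<close> undoes. The statement covers one direction and is used
  twice, with the cones exchanged.\<close>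

lemma (in gauged_cone) radial_inverse:
  assumes D: "gauged_cone D q"
    and f: "\<And>x. x \<in> base \<Longrightarrow> f x \<in> gauged_cone.base D q"
    and gf: "\<And>x. x \<in> base \<Longrightarrow> g (f x) = x"
    and x: "x \<in> C"
  shows "radial f x \<in> D" "gauged_cone.radial q g (radial f x) = x"
proof -
  interpret D: gauged_cone D q by (fact D)
  have "radial f x \<in> D \<and> D.radial g (radial f x) = x"
  proof (cases "p x = 0")
    case True
    then have "x = (\<lambda>_. 0)" "radial f x = (\<lambda>_. 0)"
      using gauge_eq_0 x by (auto simp: radial_def)
    moreover have "q (\<lambda>_. 0) = 0"
      using D.gauge_scale[OF D.zero_mem, of 0] by simp
    ultimately show ?thesis
      using D.zero_mem by (simp add: D.radial_def)
  next
    case False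
    let ?y = "\<lambda>j. x j / p x"
    have y: "?y \<in> base" by (rule normalize_mem[OF x False])
    then have fy: "f ?y \<in> D" "q (f ?y) = 1"
      using f by (auto simp: D.base_def)
    then have "q (radial f x) = p x" "radial f x \<in> D"
      using D.gauge_scale[of "f ?y" "p x"] D.scale_mem[of "f ?y" "p x"] gauge_nonneg[OF x]
      by (simp_all add: radial_def)
    then show ?thesis
      using False gf[OF y] by (simp add: D.radial_def) (simp add: radial_def)
  qed
  then show "radial f x \<in> D" "D.radial g (radial f x) = x" by auto
qed

text \<open>The radial extensions of a homeomorphism and of its inverse are mutually inverse. Both
  are continuous because the coordinates on either base are bounded by the gauge, which is 1
  there.\<close>

lemma gauged_cones_homeomorphic:
  assumes "gauged_cone C p" "gauged_cone D q"
    and "gauged_cone.base C p homeomorphic gauged_cone.base D q"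
  shows "C homeomorphic D"
proof -
  interpret C: gauged_cone C p by fact
  interpret D: gauged_cone D q by fact
  obtain f g where fg: "homeomorphism C.base D.base f g"
    using assms(3) by (auto simp: homeomorphic_def)
  then have f: "f x \<in> D.base" "g (f x) = x" if "x \<in> C.base" for x
    using that by (auto simp: homeomorphism_def)
  from fg have g: "g y \<in> C.base" "f (g y) = y" if "y \<in> D.base" for y
    using that by (auto simp: homeomorphism_def)
  have "homeomorphism C D (C.radial f) (D.radial g)"
  proof (rule homeomorphismI)
    show "continuous_on C (C.radial f)"
    proof (rule C.continuous_on_radial)
      show "\<bar>f x i\<bar> \<le> 1" if "x \<in> C.base" for x i
        using D.abs_le_gauge[of "f x" i] f(1)[OF that] by (simp add: D.base_def)
    qed (use fg in \<open>simp add: homeomorphism_def\<close>)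
    show "continuous_on D (D.radial g)"
    proof (rule D.continuous_on_radial)
      show "\<bar>g y i\<bar> \<le> 1" if "y \<in> D.base" for y i
        using C.abs_le_gauge[of "g y" i] g(1)[OF that] by (simp add: C.base_def)
    qed (use fg in \<open>simp add: homeomorphism_def\<close>)
  qed (use C.radial_inverse[OF D.gauged_cone_axioms, of f g] D.radial_inverse[OF C.gauged_cone_axioms, of g f] f g in auto)
  then show ?thesis
    by (auto simp: homeomorphic_def)
qed

section \<open>The cone over K and Euclidean space\<close>

text \<open>Testing the support, rather than taking a union over faces, matches the later
  description of the moment-angle complex by its set of non-boundary coordinates. The apex has
  support \<open>{}\<close>.\<close>

definition face_cone :: "'a set set \<Rightarrow> ('a \<Rightarrow> real) set" where
  "face_cone K = {x. (\<forall>i. 0 \<le> x i) \<and> {i. x i \<noteq> 0} \<in> K}"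

lemma face_cone_support:
  assumes "abstract_simplicial_complex V K" "x \<in> face_cone K" "i \<notin> V"
  shows "x i = 0"
proof (rule ccontr)
  assume "x i \<noteq> 0"
  then have "i \<in> {i. x i \<noteq> 0}" by simp
  with assms show False
    unfolding face_cone_def abstract_simplicial_complex_def by blast
qed

text \<open>Coordinates are nonnegative and vanish off \<open>V\<close>, so their sum dominates each
  of them. Scaling by a positive factor keeps the support; scaling by 0 turns it into
  \<open>{}\<close>, again a face.\<close>

lemma gauged_cone_face_cone:
  assumes K: "abstract_simplicial_complex V K" and V: "finite V"
  shows "gauged_cone (face_cone K) (\<lambda>x. sum x V)"
proof
  show "(\<lambda>_. 0) \<in> face_cone K"
    using K by (simp add: face_cone_def abstract_simplicial_complex_def)
  fix x :: "'a \<Rightarrow> real" assume x: "x \<in> face_cone K"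
  show "(\<lambda>i. c * x i) \<in> face_cone K" if "0 \<le> c" for c
  proof (cases "c = 0")
    case True
    then show ?thesis
      using K by (simp add: face_cone_def abstract_simplicial_complex_def)
  next
    case False
    then show ?thesis using x that by (simp add: face_cone_def)
  qed
  show "\<bar>x i\<bar> \<le> sum x V" for i
  proof (cases "i \<in> V")
    case True
    then show ?thesis
      using x member_le_sum[of i V x] V by (simp add: face_cone_def)
  next
    case False
    then show ?thesis
      using face_cone_support[OF K x] x by (simp add: face_cone_def sum_nonneg)
  qed
next
  show "continuous_on (face_cone K) (\<lambda>x. sum x V)"
    by (intro continuous_intros continuous_on_subset[OF continuous_on_product_coordinates]) auto
qed (simp add: sum_distrib_left)

text \<open>A point of a simplex has its support inside that face, hence in \<open>K\<close>;
  conversely it lies in the simplex spanned by its own support.\<close>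

lemma geometric_realisation_eq:
  assumes K: "abstract_simplicial_complex V K" and V: "finite V"
  shows "geometric_realisation K = top_of_set (gauged_cone.base (face_cone K) (\<lambda>x. sum x V))"
proof -
  have "(\<Union>I\<in>K. {x. (\<forall>i. 0 \<le> x i) \<and> (\<forall>i. i \<notin> I \<longrightarrow> x i = 0) \<and> (\<Sum>i\<in>I. x i) = 1})
      = {x \<in> face_cone K. sum x V = (1::real)}" (is "?L = ?R")
  proof (intro set_eqI iffI)
    fix x assume "x \<in> ?L"
    then obtain I where I: "I \<in> K" "\<forall>i. 0 \<le> x i" "\<forall>i. i \<notin> I \<longrightarrow> x i = 0" "(\<Sum>i\<in>I. x i) = 1"
      by auto
    then have "{i. x i \<noteq> 0} \<subseteq> I" "I \<subseteq> V"
      using K by (auto simp: abstract_simplicial_complex_def)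
    moreover have "sum x V = sum x I"
      by (rule sum.mono_neutral_right) (use I \<open>I \<subseteq> V\<close> V in auto)
    ultimately show "x \<in> ?R"
      using I K by (auto simp: face_cone_def abstract_simplicial_complex_def)
  next
    fix x assume x: "x \<in> ?R"
    let ?I = "{i. x i \<noteq> 0}"
    have "?I \<subseteq> V"
      using x K by (auto simp: face_cone_def abstract_simplicial_complex_def)
    then have "sum x V = sum x ?I"
      by (intro sum.mono_neutral_right) (use V in auto)
    then show "x \<in> ?L"
      using x by (auto simp: face_cone_def intro!: bexI[of _ ?I])
  qed
  then show ?thesis
    by (simp only: geometric_realisation_def euclidean_product_topology
        gauged_cone.base_def[OF gauged_cone_face_cone[OF K V]])
qed

text \<open>The base is the unit sphere. For \<open>n = 0\<close> the cone is the apex alone and its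
  base is empty, so dimension -1 needs no separate treatment.\<close>

lemma gauged_cone_Euclidean_space:
  "gauged_cone (topspace (Euclidean_space n)) (\<lambda>x. L2_set x {..<n})"
proof
  fix x assume x: "x \<in> topspace (Euclidean_space n)"
  show "\<bar>x i\<bar> \<le> L2_set x {..<n}" for i
  proof (cases "i < n")
    case True
    \<comment> \<open>Passing to absolute values does not change \<open>L2_set\<close> but bounds
      the coordinate from both sides.\<close>
    then show ?thesis
      using member_le_L2_set[of "{..<n}" i "\<lambda>i. \<bar>x i\<bar>"] by (simp add: L2_set_def)
  next
    case False
    then show ?thesis using x by (simp add: topspace_Euclidean_space L2_set_nonneg)
  qed
next
  show "continuous_on (topspace (Euclidean_space n)) (\<lambda>x. L2_set x {..<n})"
    unfolding L2_set_def
    by (intro continuous_intros continuous_on_subset[OF continuous_on_product_coordinates]) auto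
qed (auto simp: topspace_Euclidean_space L2_set_right_distrib)

lemma Euclidean_space_eq: "Euclidean_space n = top_of_set (topspace (Euclidean_space n))"
  by (simp add: Euclidean_space_def euclidean_product_topology)

lemma unit_sphere_eq:
  "unit_sphere n = top_of_set (gauged_cone.base (topspace (Euclidean_space n)) (\<lambda>x. L2_set x {..<n}))"
  unfolding unit_sphere_def gauged_cone.base_def[OF gauged_cone_Euclidean_space]
  by (simp add: Euclidean_space_def euclidean_product_topology subtopology_subtopology L2_set_def
      Collect_conj_eq)

lemma face_cone_homeomorphic_Euclidean_space:
  assumes "simplicial_sphere n V K"
  shows "face_cone K homeomorphic topspace (Euclidean_space n)"
proof (rule gauged_cones_homeomorphic)
  have V: "finite V" and K: "abstract_simplicial_complex V K"
    and hom: "geometric_realisation K homeomorphic_space unit_sphere n"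
    using assms by (auto simp: simplicial_sphere_def)
  show "gauged_cone (face_cone K) (\<lambda>x. sum x V)"
    by (rule gauged_cone_face_cone[OF K V])
  show "gauged_cone (topspace (Euclidean_space n)) (\<lambda>x. L2_set x {..<n})"
    by (rule gauged_cone_Euclidean_space)
  show "gauged_cone.base (face_cone K) (\<lambda>x. sum x V) homeomorphic
      gauged_cone.base (topspace (Euclidean_space n)) (\<lambda>x. L2_set x {..<n})"
    using hom by (simp add: geometric_realisation_eq[OF K V] unit_sphere_eq homeomorphic_space_top_of_set)
qed

section \<open>Half-plane charts of the disc\<close>

text \<open>An interior point is handled by a translation. At a boundary point the coordinates are
  the distance to the circle and, after rotating \<open>a\<close> to 1, the imaginary part.\<close>

lemma disc_half_plane_chart:
  fixes a :: complex
  assumes "a \<in> cball 0 1"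
  obtains U V \<phi> \<psi> where "open U" "open V" "a \<in> U"
    "homeomorphism (cball 0 1 \<inter> U) ({0..} \<times> (UNIV :: real set) \<inter> V) \<phi> \<psi>"
    "\<And>w. w \<in> cball 0 1 \<inter> U \<Longrightarrow> fst (\<phi> w) = (0::real) \<longleftrightarrow> norm w = 1"
proof (cases "norm a = 1")
  case False
  let ?U = "ball 0 1 :: complex set" and ?V = "{p :: real \<times> real. norm (Complex (fst p - 2) (snd p)) < 1}"
  \<comment> \<open>The shift by 2 makes the first coordinate positive.\<close>
  let ?\<phi> = "\<lambda>w. (Re w + 2, Im w)" and ?\<psi> = "\<lambda>p. Complex (fst p - 2) (snd p)"
  have pos: "0 < Re w + 2" if "norm w < 1" for w
    using abs_Re_le_cmod[of w] that by linarith
  have pos': "0 < r" if "norm (Complex (r - 2) s) < 1" for r s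
    using pos[OF that] by simp
  have "continuous_on (UNIV :: (real \<times> real) set) ?\<psi>"
    unfolding Complex_eq by (intro continuous_intros)
  then have "open ?V"
    by (intro open_Collect_less continuous_intros)
  moreover have "homeomorphism (cball 0 1 \<inter> ?U) ({0..} \<times> UNIV \<inter> ?V) ?\<phi> ?\<psi>"
  proof (rule homeomorphismI)
    show "continuous_on ({0..} \<times> UNIV \<inter> ?V) ?\<psi>"
      using \<open>continuous_on UNIV ?\<psi>\<close> by (rule continuous_on_subset) simp
  qed (auto intro!: continuous_intros intro: less_imp_le[OF pos])
  moreover have "a \<in> ?U"
    using assms False by auto
  ultimately show thesis
    using that[of ?U ?V ?\<phi> ?\<psi>] by (fastforce dest: pos)
next
  case True
  \<comment> \<open>With \<open>u = w * cnj a\<close>, a point of the right half-plane is determined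
    by \<open>norm u\<close> and \<open>Im u\<close>. For such \<open>u\<close> one has
    \<open>\<bar>Im u\<bar> < norm u\<close>, which is the inequality defining
    \<open>?V\<close>.\<close>
  let ?U = "{w. 0 < Re (w * cnj a)}" and ?V = "{p :: real \<times> real. fst p + \<bar>snd p\<bar> < 1}"
  let ?\<phi> = "\<lambda>w. (1 - norm w, Im (w * cnj a))"
    and ?\<psi> = "\<lambda>p. a * Complex (sqrt ((1 - fst p)\<^sup>2 - (snd p)\<^sup>2)) (snd p)"
  have aa: "a * cnj a = 1" "cnj a * a = 1"
    using True complex_norm_square[of a] by (simp_all add: mult.commute)
  have norm_u: "norm (w * cnj a) = norm w" for w
    using True by (simp add: norm_mult)
  have "open ?U" "open ?V"
    by (intro open_Collect_less continuous_intros)+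
  moreover have "a \<in> ?U"
    unfolding mem_Collect_eq aa by simp
  moreover have "homeomorphism (cball 0 1 \<inter> ?U) ({0..} \<times> UNIV \<inter> ?V) ?\<phi> ?\<psi>"
  proof (rule homeomorphismI)
    show "continuous_on (cball 0 1 \<inter> ?U) ?\<phi>"
      by (intro continuous_intros)
    show "continuous_on ({0..} \<times> UNIV \<inter> ?V) ?\<psi>"
      unfolding Complex_eq by (intro continuous_intros)
    show "?\<phi> ` (cball 0 1 \<inter> ?U) \<subseteq> {0..} \<times> UNIV \<inter> ?V"
    proof (rule image_subsetI)
      fix w assume w: "w \<in> cball 0 1 \<inter> ?U"
      define u where "u = w * cnj a"
      have "Re u \<noteq> 0"
        using w by (simp add: u_def)
      have norm_w: "norm w = norm u"
        using norm_u[of w] by (simp only: u_def)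
      then have "norm u \<le> 1"
        using w by simp
      moreover have "\<bar>Im u\<bar>\<^sup>2 < (norm u)\<^sup>2"
        using \<open>Re u \<noteq> 0\<close> by (simp add: cmod_power2)
      then have "\<bar>Im u\<bar> < norm u"
        by (rule power2_less_imp_less) simp
      ultimately show "?\<phi> w \<in> {0..} \<times> UNIV \<inter> ?V"
        unfolding u_def[symmetric] norm_w by simp
    qed
    show "?\<psi> (?\<phi> w) = w" if "w \<in> cball 0 1 \<inter> ?U" for w
    proof -
      define u where "u = w * cnj a"
      have "0 < Re u" "norm w = norm u"
        using that norm_u[of w] by (simp_all add: u_def)
      \<comment> \<open>The nonnegative root is the correct one because \<open>Re u\<close> is
        positive.\<close>
      then have "sqrt ((norm w)\<^sup>2 - (Im u)\<^sup>2) = Re u"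
        by (simp add: cmod_power2)
      then have "?\<psi> (?\<phi> w) = a * u"
        unfolding u_def[symmetric] by simp
      also have "\<dots> = w * (a * cnj a)"
        by (simp only: u_def mult.left_commute)
      finally show ?thesis
        by (simp only: aa mult_1_right)
    qed
    \<comment> \<open>Here \<open>c\<close> is the point of the right half-plane with norm
      \<open>1 - r\<close> and imaginary part \<open>s\<close>; it exists since
      \<open>\<bar>s\<bar> < 1 - r\<close>.\<close>
    have u: "Complex (sqrt ((1 - r)\<^sup>2 - s\<^sup>2)) s = c \<Longrightarrow> norm c = 1 - r \<and> 0 < Re c \<and> Im c = s"
      if "0 \<le> r" "r + \<bar>s\<bar> < 1" for r s c
    proof -
      have "s\<^sup>2 < (1 - r)\<^sup>2"
        using that abs_le_square_iff[of "1 - r" s] by (simp add: linorder_not_le[symmetric])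
      then show "Complex (sqrt ((1 - r)\<^sup>2 - s\<^sup>2)) s = c \<Longrightarrow> norm c = 1 - r \<and> 0 < Re c \<and> Im c = s"
        using that by (auto simp: cmod_def)
    qed
    have inv: "norm (?\<psi> p) = 1 - fst p \<and> ?\<psi> p * cnj a = Complex (sqrt ((1 - fst p)\<^sup>2 - (snd p)\<^sup>2)) (snd p)
        \<and> 0 < Re (?\<psi> p * cnj a)" if "p \<in> {0..} \<times> UNIV \<inter> ?V" for p
    proof -
      obtain c where c: "c = Complex (sqrt ((1 - fst p)\<^sup>2 - (snd p)\<^sup>2)) (snd p)" by blast
      have "a * c * cnj a = c * (a * cnj a)"
        by (simp only: mult_ac)
      then have acc: "a * c * cnj a = c"
        by (simp only: aa mult_1_right)
      have "0 \<le> fst p" "fst p + \<bar>snd p\<bar> < 1"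
        using that by auto
      from u[OF this c[symmetric]] show ?thesis
        unfolding c[symmetric] acc using True by (simp add: norm_mult)
    qed
    show "?\<psi> ` ({0..} \<times> UNIV \<inter> ?V) \<subseteq> cball 0 1 \<inter> ?U"
      using inv by fastforce
    show "?\<phi> (?\<psi> p) = p" if "p \<in> {0..} \<times> UNIV \<inter> ?V" for p
      using inv[OF that] by (auto simp only: prod_eq_iff fst_conv snd_conv complex.sel)
  qed
  ultimately show thesis
    by (rule that[of ?U ?V ?\<phi> ?\<psi>]) simp
qed

section \<open>Global properties of the moment-angle complex\<close>

text \<open>The set of coordinates off the circle is the smallest \<open>I\<close> whose piece can
  contain \<open>z\<close>. As \<open>K\<close> is closed under subsets, some face works exactly
  when this one is a face.\<close>

lemma moment_angle_complex_eq:
  assumes K: "abstract_simplicial_complex {1..m} K"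
  shows "moment_angle_complex m K =
    top_of_set {z \<in> {1..m} \<rightarrow>\<^sub>E cball 0 1. {i \<in> {1..m}. norm (z i) \<noteq> 1} \<in> K}"
proof -
  have "(\<Union>I\<in>K. {z \<in> {1..m} \<rightarrow>\<^sub>E cball 0 1. \<forall>i\<in>{1..m} - I. norm (z i) = 1})
      = {z \<in> {1..m} \<rightarrow>\<^sub>E cball 0 1. {i \<in> {1..m}. norm (z i :: complex) \<noteq> 1} \<in> K}" (is "?L = ?R")
  proof
    show "?L \<subseteq> ?R"
    proof clarify
      fix I z assume I: "I \<in> K" "\<forall>i\<in>{1..m} - I. norm (z i :: complex) = 1"
      then have "{i \<in> {1..m}. norm (z i) \<noteq> 1} \<subseteq> I" by auto
      then show "{i \<in> {1..m}. norm (z i) \<noteq> 1} \<in> K"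
        using I(1) K unfolding abstract_simplicial_complex_def by blast
    qed
    show "?R \<subseteq> ?L"
    proof clarify
      fix z :: "nat \<Rightarrow> complex"
      assume "z \<in> {1..m} \<rightarrow>\<^sub>E cball 0 1" "{i \<in> {1..m}. norm (z i) \<noteq> 1} \<in> K"
      then show "z \<in> ?L"
        by (intro UN_I[of "{i \<in> {1..m}. norm (z i) \<noteq> 1}"]) auto
    qed
  qed
  moreover have "({1..m} \<rightarrow>\<^sub>E cball 0 1) \<inter> ?R = ?R"
    by blast
  ultimately show ?thesis
    by (simp only: moment_angle_complex_def top_of_set_PiE subtopology_subtopology)
qed

text \<open>Each piece is a product of discs, for indices in \<open>I\<close>, and circles, for the
  others; there are finitely many pieces.\<close>

lemma compact_space_moment_angle_complex:
  assumes K: "abstract_simplicial_complex {1..m} K"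
  shows "compact_space (moment_angle_complex m K)"
  unfolding moment_angle_complex_def
proof (intro compact_space_subtopology compactin_Union)
  show "finite ((\<lambda>I. {z \<in> {1..m} \<rightarrow>\<^sub>E cball 0 1. \<forall>i\<in>{1..m} - I. norm (z i :: complex) = 1}) ` K)"
    using K finite_subset[of K "Pow {1..m}"] by (auto simp: abstract_simplicial_complex_def)
  fix A assume "A \<in> (\<lambda>I. {z \<in> {1..m} \<rightarrow>\<^sub>E cball 0 1. \<forall>i\<in>{1..m} - I. norm (z i :: complex) = 1}) ` K"
  then obtain I where "A = {z \<in> {1..m} \<rightarrow>\<^sub>E cball 0 1. \<forall>i\<in>{1..m} - I. norm (z i :: complex) = 1}"
    by blast
  then have A: "A = PiE {1..m} (\<lambda>i. {w \<in> cball 0 1. i \<notin> I \<longrightarrow> norm w = 1})"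
    by (auto simp: PiE_iff extensional_def)
  have "{w \<in> cball 0 1. i \<notin> I \<longrightarrow> norm w = 1} = (if i \<in> I then cball 0 1 else sphere (0::complex) 1)" for i
    by auto
  then have "compact {w \<in> cball (0::complex) 1. i \<notin> I \<longrightarrow> norm w = 1}" for i
    by simp
  then show "compactin (product_topology (\<lambda>i. top_of_set (cball 0 1)) {1..m}) A"
    unfolding A compactin_PiE by (auto simp: compactin_subtopology)
qed

lemma second_countable_space_top_of_set:
  fixes S :: "'a::second_countable_topology set"
  shows "second_countable_space (top_of_set S)"
proof -
  obtain B :: "'a set set" where B: "countable B" "topological_basis B"
    using ex_countable_basis by blast
  show ?thesis
    unfolding second_countable_space_def
  proof (intro exI[of _ "(\<inter>) S ` B"] conjI allI impI ballI)
    fix U x assume "openin (top_of_set S) U \<and> x \<in> U"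
    then obtain T where T: "open T" "U = S \<inter> T" "x \<in> T"
      by (auto simp: openin_open)
    then obtain b where "b \<in> B" "x \<in> b" "b \<subseteq> T"
      using B(2) by (meson topological_basisE)
    then show "\<exists>b\<in>(\<inter>) S ` B. x \<in> b \<and> b \<subseteq> U"
      using T \<open>openin (top_of_set S) U \<and> x \<in> U\<close> by auto
  qed (use B topological_basis_open in \<open>auto simp: openin_open\<close>)
qed

section \<open>Charts of the moment-angle complex\<close>

text \<open>The disc charts turn the condition defining \<open>Z\<close> into membership of the
  radial vector in the cone, and the given homeomorphism straightens the cone. The angular
  coordinates are unconstrained apart from the open sets \<open>V i\<close>.\<close>

lemma moment_angle_complex_chart:
  fixes m :: nat and K :: "nat set set"
  defines "Z \<equiv> {z \<in> {1..m} \<rightarrow>\<^sub>E cball (0::complex) 1. {i \<in> {1..m}. norm (z i) \<noteq> 1} \<in> K}"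
  assumes K: "abstract_simplicial_complex {1..m} K"
    and hom: "face_cone K homeomorphic topspace (Euclidean_space n)"
    and z: "z \<in> Z"
  obtains U W where "openin (top_of_set Z) U" "z \<in> U"
    "openin (top_of_set (topspace (Euclidean_space (m + n)))) W" "U homeomorphic W"
proof -
  let ?D = "\<lambda>n. topspace (Euclidean_space n)"
  have "\<forall>i\<in>{1..m}. \<exists>U V \<phi> \<psi>. open U \<and> open V \<and> z i \<in> U
      \<and> homeomorphism (cball 0 1 \<inter> U) ({0..} \<times> (UNIV :: real set) \<inter> V) \<phi> \<psi>
      \<and> (\<forall>w\<in>cball 0 1 \<inter> U. fst (\<phi> w) = (0::real) \<longleftrightarrow> norm w = 1)"
  proof
    fix i assume "i \<in> {1..m}"
    then have "z i \<in> cball 0 1"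
      using z by (auto simp: Z_def PiE_iff)
    then show "\<exists>U V \<phi> \<psi>. open U \<and> open V \<and> z i \<in> U
      \<and> homeomorphism (cball 0 1 \<inter> U) ({0..} \<times> (UNIV :: real set) \<inter> V) \<phi> \<psi>
      \<and> (\<forall>w\<in>cball 0 1 \<inter> U. fst (\<phi> w) = (0::real) \<longleftrightarrow> norm w = 1)"
      by (rule disc_half_plane_chart) blast
  qed
  then obtain U V \<phi> \<psi> where UV: "\<And>i. i \<in> {1..m} \<Longrightarrow> open (U i) \<and> open (V i) \<and> z i \<in> U i
      \<and> homeomorphism (cball 0 1 \<inter> U i) ({0..} \<times> (UNIV :: real set) \<inter> V i) (\<phi> i) (\<psi> i)
      \<and> (\<forall>w\<in>cball 0 1 \<inter> U i. fst (\<phi> i w) = (0::real) \<longleftrightarrow> norm w = 1)"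
    unfolding bchoice_iff by blast
  obtain F G where FG: "homeomorphism (face_cone K) (?D n) F G"
    using hom by (auto simp: homeomorphic_def)
  \<comment> \<open>Padding with 0 places the vector in \<open>face_cone K\<close>, which consists
    of functions on all of \<open>nat\<close>.\<close>
  define r where "r = (\<lambda>w i. if i \<in> {1..m} then fst (\<phi> i (w i)) else 0)"
  \<comment> \<open>The first \<open>n\<close> slots hold the straightened radial part. Discs are
    numbered from 1, so disc \<open>i\<close> has its second coordinate in slot
    \<open>n + (i - 1)\<close>; all slots from \<open>m + n\<close> on are 0.\<close>
  define \<Phi> where "\<Phi> = (\<lambda>w k. if k < n then F (r w) k
    else if k < m + n then snd (\<phi> (k - n + 1) (w (k - n + 1))) else 0)"
  define tr where "tr = (\<lambda>(y :: nat \<Rightarrow> real) k. if k < n then y k else 0)"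
  \<comment> \<open>This reads the half-plane coordinates of disc \<open>i\<close> back from
    \<open>y\<close>.\<close>
  define \<rho> where "\<rho> = (\<lambda>y i. (G (tr y) i, y (n + (i - 1))))"
  \<comment> \<open>The restriction supplies the value \<open>undefined\<close> that points of
    \<open>Z\<close> have outside \<open>{1..m}\<close>.\<close>
  define \<Psi> where "\<Psi> = (\<lambda>y. \<lambda>i\<in>{1..m}. \<psi> i (\<rho> y i))"
  define A where "A = {w \<in> Z. \<forall>i\<in>{1..m}. w i \<in> U i}"
  define B where "B = {y \<in> ?D (m + n). \<forall>i\<in>{1..m}. \<rho> y i \<in> V i}"

  have cont_F: "continuous_on (face_cone K) F" and cont_G: "continuous_on (?D n) G"
    using FG by (auto simp: homeomorphism_def)
  have F: "F x \<in> ?D n" "G (F x) = x" if "x \<in> face_cone K" for x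
    using FG that by (auto simp: homeomorphism_def)
  have G: "G y \<in> face_cone K" "F (G y) = y" if "y \<in> ?D n" for y
    using FG that by (auto simp: homeomorphism_def)
  note supp = face_cone_support[OF K]
  have cont_\<phi>: "continuous_on (cball 0 1 \<inter> U i) (\<phi> i)"
    and cont_\<psi>: "continuous_on ({0..} \<times> UNIV \<inter> V i) (\<psi> i)"
    if "i \<in> {1..m}" for i
    using UV[OF that] by (auto simp: homeomorphism_def)
  have \<phi>: "0 \<le> fst (\<phi> i w)" "\<phi> i w \<in> V i" "\<psi> i (\<phi> i w) = w" "fst (\<phi> i w) = 0 \<longleftrightarrow> norm w = 1"
    if "i \<in> {1..m}" "w \<in> cball 0 1" "w \<in> U i" for i w
  proof -
    have w: "w \<in> cball 0 1 \<inter> U i"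
      using that by simp
    then have "\<phi> i w \<in> {0..} \<times> UNIV \<inter> V i"
      using UV[OF that(1)] unfolding homeomorphism_def by blast
    then show "0 \<le> fst (\<phi> i w)" "\<phi> i w \<in> V i"
      by (auto simp: mem_Times_iff)
    show "\<psi> i (\<phi> i w) = w" "fst (\<phi> i w) = 0 \<longleftrightarrow> norm w = 1"
      using UV[OF that(1)] w unfolding homeomorphism_def by blast+
  qed
  have \<psi>: "\<psi> i p \<in> cball 0 1" "\<psi> i p \<in> U i" "\<phi> i (\<psi> i p) = p"
    if "i \<in> {1..m}" "p \<in> V i" "0 \<le> fst p" for i p
  proof -
    have "p \<in> {0..} \<times> UNIV \<inter> V i"
      using that by (cases p) auto
    with UV[OF that(1)] show "\<psi> i p \<in> cball 0 1" "\<psi> i p \<in> U i" "\<phi> i (\<psi> i p) = p"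
      unfolding homeomorphism_def by blast+
  qed
  have A: "w i \<in> cball 0 1" "w i \<in> U i" if "w \<in> A" "i \<in> {1..m}" for w i
    using that by (auto simp: A_def Z_def PiE_iff)

  have r: "r w \<in> face_cone K" if "w \<in> A" for w
  proof -
    \<comment> \<open>The first chart coordinate vanishes exactly on the circle, so supports
      correspond to sets of non-boundary coordinates.\<close>
    have "{i. r w i \<noteq> 0} = {i \<in> {1..m}. norm (w i) \<noteq> 1}"
      using \<phi>(4) A[OF that] by (auto simp: r_def)
    then show ?thesis
      using that \<phi>(1) A[OF that] by (auto simp: face_cone_def r_def A_def Z_def)
  qed
  have tr_mem: "tr y \<in> ?D n" for y
    by (simp add: tr_def topspace_Euclidean_space)
  have Gtr: "G (tr y) \<in> face_cone K" for y
    using G(1) tr_mem by blast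
  have cont_tr: "continuous_on S tr" for S
    unfolding tr_def
  proof (rule continuous_on_coordinatewise_then_product)
    show "continuous_on S (\<lambda>y. if k < n then y k else 0)" for k
      by (cases "k < n") (auto intro!: continuous_intros continuous_on_subset[OF continuous_on_product_coordinates])
  qed
  have cont_\<rho>: "continuous_on S (\<lambda>y. \<rho> y i)" for S i
  proof -
    have "continuous_on S (\<lambda>y. G (tr y))"
      by (rule continuous_on_compose2[OF cont_G cont_tr]) (use tr_mem in auto)
    then have "continuous_on S (\<lambda>y. G (tr y) i)"
      by (rule continuous_on_product_then_coordinatewise)
    then show ?thesis
      unfolding \<rho>_def
      by (rule continuous_on_Pair) (rule continuous_on_subset[OF continuous_on_product_coordinates], simp)
  qed
  have cont_coord: "continuous_on A (\<lambda>w. w i)" for i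
    by (rule continuous_on_subset[OF continuous_on_product_coordinates]) simp
  have cont_\<phi>A: "continuous_on A (\<lambda>w. \<phi> i (w i))" if "i \<in> {1..m}" for i
    by (rule continuous_on_compose2[OF cont_\<phi>[OF that] cont_coord]) (use A that in auto)
  have tr_\<Phi>: "tr (\<Phi> w) = F (r w)" if "w \<in> A" for w
    using F(1)[OF r[OF that]] by (auto simp: tr_def \<Phi>_def topspace_Euclidean_space fun_eq_iff)
  have \<rho>_\<Phi>: "\<rho> (\<Phi> w) i = \<phi> i (w i)" if "w \<in> A" "i \<in> {1..m}" for w i
  proof -
    \<comment> \<open>The bound \<open>1 \<le> i\<close> ensures that the truncated subtraction
      gives \<open>k - n + 1 = i\<close>.\<close>
    define k where "k = n + (i - 1)"
    have "k - n + 1 = i" "\<not> k < n" "k < m + n"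
      using that(2) by (auto simp: k_def)
    then have "\<Phi> w k = snd (\<phi> i (w i))"
      by (simp add: \<Phi>_def)
    then show ?thesis
      using that by (simp add: \<rho>_def tr_\<Phi> F(2) r k_def) (simp add: r_def)
  qed
  have \<rho>_nonneg: "0 \<le> fst (\<rho> y i)" for y i
    using Gtr[of y] by (simp add: \<rho>_def face_cone_def)
  have \<Psi>: "\<Psi> y i \<in> cball 0 1" "\<Psi> y i \<in> U i" "\<phi> i (\<Psi> y i) = \<rho> y i"
    if "y \<in> B" "i \<in> {1..m}" for y i
    using \<psi>[OF that(2) _ \<rho>_nonneg, of y] that by (auto simp: \<Psi>_def B_def)
  \<comment> \<open>Outside \<open>{1..m}\<close> both sides are 0: the left by padding, the right
    because supports of cone points are faces.\<close>
  have r_\<Psi>: "r (\<Psi> y) = G (tr y)" if "y \<in> B" for y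
    using \<Psi>(3)[OF that] supp[OF Gtr] by (auto simp: r_def \<rho>_def fun_eq_iff)

  have "homeomorphism A B \<Phi> \<Psi>"
  proof (rule homeomorphismI)
    show "continuous_on A \<Phi>"
    proof (rule continuous_on_coordinatewise_then_product)
      fix k
      have "continuous_on A (\<lambda>w. r w i)" for i
        unfolding r_def by (cases "i \<in> {1..m}") (simp_all only: if_True if_False simp_thms continuous_on_fst[OF cont_\<phi>A] continuous_on_const)
      then have "continuous_on A r"
        by (rule continuous_on_coordinatewise_then_product)
      then have "continuous_on A (\<lambda>w. F (r w))"
        by (rule continuous_on_compose2[OF cont_F]) (use r in auto)
      then have "continuous_on A (\<lambda>w. F (r w) k)"
        by (rule continuous_on_product_then_coordinatewise)
      moreover have "continuous_on A (\<lambda>w. snd (\<phi> (k - n + 1) (w (k - n + 1))))"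
        if "\<not> k < n" "k < m + n"
        by (intro continuous_on_snd cont_\<phi>A) (use that in auto)
      ultimately show "continuous_on A (\<lambda>w. \<Phi> w k)"
        by (cases "k < n"; cases "k < m + n") (simp_all add: \<Phi>_def)
    qed
    show "continuous_on B \<Psi>"
    proof (rule continuous_on_coordinatewise_then_product)
      fix i
      show "continuous_on B (\<lambda>y. \<Psi> y i)"
      proof (cases "i \<in> {1..m}")
        case True
        have "(\<lambda>y. \<rho> y i) ` B \<subseteq> {0..} \<times> UNIV \<inter> V i"
          using True \<rho>_nonneg by (force simp: B_def mem_Times_iff)
        then show ?thesis
          using True continuous_on_compose2[OF cont_\<psi>[OF True] cont_\<rho>] by (simp add: \<Psi>_def)
      next
        case False
        then have "(\<lambda>y. \<Psi> y i) = (\<lambda>_. undefined)"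
          unfolding \<Psi>_def restrict_def by (simp only: if_False)
        then show ?thesis
          by (simp only: continuous_on_const)
      qed
    qed
    show "\<Phi> ` A \<subseteq> B"
    proof (rule image_subsetI)
      fix w assume w: "w \<in> A"
      have "\<Phi> w \<in> ?D (m + n)"
        by (simp add: \<Phi>_def topspace_Euclidean_space)
      then show "\<Phi> w \<in> B"
        using \<phi>(2) A[OF w] \<rho>_\<Phi>[OF w] by (simp add: B_def)
    qed
    show "\<Psi> ` B \<subseteq> A"
    proof (rule image_subsetI)
      fix y assume y: "y \<in> B"
      \<comment> \<open>Conversely, the support of the cone point \<open>G (tr y)\<close> is a face,
        which puts \<open>\<Psi> y\<close> into \<open>Z\<close>.\<close>
      have "{i \<in> {1..m}. norm (\<Psi> y i) \<noteq> 1} = {i \<in> {1..m}. fst (\<rho> y i) \<noteq> 0}"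
        using \<phi>(4)[OF _ \<Psi>(1,2)[OF y]] \<Psi>(3)[OF y] by auto
      also have "\<dots> = {i. G (tr y) i \<noteq> 0}"
        using supp[OF Gtr] by (auto simp: \<rho>_def)
      also have "\<dots> \<in> K"
        using Gtr[of y] by (simp add: face_cone_def)
      finally show "\<Psi> y \<in> A"
        using \<Psi>(1,2)[OF y] by (simp add: A_def Z_def PiE_iff) (simp add: \<Psi>_def)
    qed
    show "\<Psi> (\<Phi> w) = w" if "w \<in> A" for w
    proof
      fix i
      show "\<Psi> (\<Phi> w) i = w i"
        using that \<rho>_\<Phi>[OF that, of i] \<phi>(3)[OF _ A[OF that]]
        by (cases "i \<in> {1..m}") (auto simp: \<Psi>_def A_def Z_def PiE_iff extensional_def)
    qed
    show "\<Phi> (\<Psi> y) = y" if "y \<in> B" for y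
    proof
      fix k
      consider "k < n" | "\<not> k < n" "k < m + n" | "\<not> k < m + n" by blast
      then show "\<Phi> (\<Psi> y) k = y k"
      proof cases
        case 1
        then show ?thesis
          by (simp add: \<Phi>_def r_\<Psi>[OF that] G(2)[OF tr_mem]) (simp add: tr_def)
      next
        case 2
        then have "k - n + 1 \<in> {1..m}" "n + (k - n) = k" by auto
        then show ?thesis
          using 2 \<Psi>(3)[OF that, of "k - n + 1"] by (simp add: \<Phi>_def \<rho>_def)
      next
        case 3
        then show ?thesis
          using that by (simp add: \<Phi>_def B_def topspace_Euclidean_space)
      qed
    qed
  qed
  then have "A homeomorphic B"
    by (auto simp: homeomorphic_def)
  moreover have "openin (top_of_set Z) A"
  proof -
    have "openin (top_of_set Z) (Z \<inter> (\<lambda>w. w i) -` U i)" if "i \<in> {1..m}" for i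
      by (rule continuous_openin_preimage_gen[OF continuous_on_subset[OF continuous_on_product_coordinates]])
        (use UV[OF that] in auto)
    \<comment> \<open>Intersecting with the whole space covers \<open>m = 0\<close>, where the
      intersection over no indices is \<open>UNIV\<close>.\<close>
    then have "openin (top_of_set Z) ((\<Inter>i\<in>{1..m}. Z \<inter> (\<lambda>w. w i) -` U i) \<inter> topspace (top_of_set Z))"
      by (intro openin_INT) auto
    moreover have "(\<Inter>i\<in>{1..m}. Z \<inter> (\<lambda>w. w i) -` U i) \<inter> topspace (top_of_set Z) = A"
      by (auto simp: A_def)
    ultimately show ?thesis by simp
  qed
  moreover have "openin (top_of_set (?D (m + n))) B"
  proof -
    have "openin (top_of_set (?D (m + n))) (?D (m + n) \<inter> (\<lambda>y. \<rho> y i) -` V i)" if "i \<in> {1..m}" for i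
      by (rule continuous_openin_preimage_gen[OF cont_\<rho>]) (use UV[OF that] in auto)
    then have "openin (top_of_set (?D (m + n)))
        ((\<Inter>i\<in>{1..m}. ?D (m + n) \<inter> (\<lambda>y. \<rho> y i) -` V i) \<inter> topspace (top_of_set (?D (m + n))))"
      by (intro openin_INT) auto
    moreover have "(\<Inter>i\<in>{1..m}. ?D (m + n) \<inter> (\<lambda>y. \<rho> y i) -` V i)
        \<inter> topspace (top_of_set (?D (m + n))) = B"
      by (auto simp: B_def)
    ultimately show ?thesis by simp
  qed
  moreover have "z \<in> A"
    using z UV by (simp add: A_def)
  ultimately show thesis
    using that by blast
qed

text \<open>The Hausdorff property and second countability are inherited from the ambient function
  space; compactness and the charts use the structure of \<open>K\<close>.\<close>

theorem lemma3p2p2: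
  fixes m n :: nat and K :: "nat set set"
  assumes "simplicial_sphere n {1..m} K"
  shows "closed_manifold (m + n) (moment_angle_complex m K)"
proof -
  have K: "abstract_simplicial_complex {1..m} K"
    using assms by (simp add: simplicial_sphere_def)
  define Z where "Z = {z \<in> {1..m} \<rightarrow>\<^sub>E cball (0::complex) 1. {i \<in> {1..m}. norm (z i) \<noteq> 1} \<in> K}"
  have Z: "moment_angle_complex m K = top_of_set Z"
    unfolding Z_def by (rule moment_angle_complex_eq[OF K])
  have "Hausdorff_space (top_of_set Z)"
    by (simp add: Hausdorff_space_subtopology)
  moreover have "\<exists>U W. openin (top_of_set Z) U \<and> z \<in> U \<and> openin (Euclidean_space (m + n)) W \<and>
      subtopology (top_of_set Z) U homeomorphic_space subtopology (Euclidean_space (m + n)) W"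
    if "z \<in> topspace (top_of_set Z)" for z
  proof -
    have "z \<in> Z"
      using that by simp
    then obtain U W where U: "openin (top_of_set Z) U" "z \<in> U" and "U homeomorphic W"
      and W: "openin (top_of_set (topspace (Euclidean_space (m + n)))) W"
      unfolding Z_def
      by (rule moment_angle_complex_chart[OF K face_cone_homeomorphic_Euclidean_space[OF assms]])
    have "subtopology (top_of_set Z) U = top_of_set U"
      using openin_imp_subset[OF U(1)] by (simp add: subtopology_subtopology Int_absorb1)
    moreover have "subtopology (Euclidean_space (m + n)) W = top_of_set W"
      using openin_imp_subset[OF W]
      by (subst Euclidean_space_eq) (simp only: subtopology_subtopology Int_absorb1)
    ultimately show ?thesis
      using U W \<open>U homeomorphic W\<close> Euclidean_space_eq[of "m + n"]
      by (metis homeomorphic_space_top_of_set)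
  qed
  ultimately show ?thesis
    using second_countable_space_top_of_set[of Z] compact_space_moment_angle_complex[OF K]
    unfolding closed_manifold_def topological_manifold_def Z by blast
qed

end
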